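(* Let $K$ be a field of characteristic zero. A finitely generated RC algebra $(M,[\,,]_n)$ over $K$ is a canonical RC algebra if and only if it is a sub-RC algebra of a standard RC algebra $(\widetilde M=M[t_1],[\,,]_{D,n})$, where $t_1\notin M$ has degree $2$ and $D$ is the degree-$2$ derivation of $\widetilde M$ defining its standard structure, with the following property: there is a derivation $\delta$ of $\widetilde M$ with $\ker\delta=M$ such that $D$, $\delta$ and the weight operator $W$ (defined by $Wf=kf$ for $f\in\widetilde M_k$) satisfy $$[D,\delta]=W,\qquad [W,D]=2D,\qquad [W,\delta]=-2\delta,$$ i.e. they endow $\widetilde M$ with an $\mathfrak{sl}_2(\mathbb{C})$-module structure.
   Context: Gradings may take values in $\frac1N\mathbb{Z}_{\ge0}$ for a fixed positive integer $N$; $[A,B]=AB-BA$ for operators. Write $(\alpha)_s=\alpha(\alpha+1)\cdots(\alpha+s-1)$; $f$ has degree $k$, $g$ degree $l$. An RC structure on a graded $K$-vector space is a family of bilinear maps $[\,,]_n\colon M_k\otimes M_l\to M_{k+l+2n}$ satisfying all algebraic identities satisfied by the classical Rankin–Cohen brackets of modular forms. A standard RC algebra is a commutative graded algebra with a degree-$2$ derivation $D$ and brackets $[f,g]_{D,n}=\sum_{r+s=n}(-1)^r\frac{(k+n-1)_s}{s!}\frac{(l+n-1)_r}{r!}D^rf\,D^sg$. A canonical RC algebra is a commutative associative graded algebra $M$ with a degree-$2$ derivation $\partial$ and $\Phi\in M_4$, with brackets $[f,g]_{\partial,\Phi,n}=\sum_{r+s=n}(-1)^r\frac{(k+n-1)_s}{s!}\frac{(l+n-1)_r}{r!}f_rg_s$,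 where $f_0=f$, $f_{r+1}=\partial f_r+r(r+k-1)\Phi f_{r-1}$, and similarly $g_{s+1}=\partial g_s+s(s+l-1)\Phi g_{s-1}$. A sub-RC algebra is a graded subalgebra closed under all brackets, with the restricted brackets.
   Formalization: The bracket coefficients are the binomials C(k+n-1,s), C(l+n-1,r), i.e. (α)_s is the descending product; with the ascending product the claim fails, e.g. for M=K[x], deg x=2, ∂=0, Φ=0, where [1,x]_{D,2}=D²x≠0. *)

theory Defs
  imports "HOL-Analysis.Analysis" "HOL-Computational_Algebra.Polynomial"
begin

locale graded_algebra = vector_space sc
  for sc :: "'k::field_char_0 \<Rightarrow> 'a::comm_ring_1 \<Rightarrow> 'a"
    and N :: nat and Gr :: "rat \<Rightarrow> 'a set" +
  assumes N_pos: "N > 0"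
    and scale_mult: "\<And>c x y. sc c (x * y) = sc c x * y"
    and subspace_Gr: "\<And>k. subspace (Gr k)"
    and degrees: "\<And>k. Gr k \<noteq> {0} \<Longrightarrow> \<exists>j::nat. k = of_nat j / of_nat N"
    and direct_sum: "\<And>x. \<exists>!h. finite {k. h k \<noteq> 0} \<and> (\<forall>k. h k \<in> Gr k) \<and> x = (\<Sum>k | h k \<noteq> 0. h k)"
    and one_Gr: "1 \<in> Gr 0"
    and mult_Gr: "\<And>k l x y. x \<in> Gr k \<Longrightarrow> y \<in> Gr l \<Longrightarrow> x * y \<in> Gr (k + l)"

definition derivation :: "('k::field \<Rightarrow> 'a::comm_ring_1 \<Rightarrow> 'a) \<Rightarrow> ('a \<Rightarrow> 'a) \<Rightarrow> bool" where
  "derivation sc D \<longleftrightarrow>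
     Vector_Spaces.linear sc sc D \<and> (\<forall>x y. D (x * y) = D x * y + x * D y)"

definition derivation_deg2 ::
  "('k::field \<Rightarrow> 'a::comm_ring_1 \<Rightarrow> 'a) \<Rightarrow> (rat \<Rightarrow> 'a set) \<Rightarrow> ('a \<Rightarrow> 'a) \<Rightarrow> bool" where
  "derivation_deg2 sc Gr D \<longleftrightarrow>
     derivation sc D \<and> (\<forall>k. \<forall>x \<in> Gr k. D x \<in> Gr (k + 2))"

definition weight_operator ::
  "('k::field_char_0 \<Rightarrow> 'a::comm_ring_1 \<Rightarrow> 'a) \<Rightarrow> (rat \<Rightarrow> 'a set) \<Rightarrow> ('a \<Rightarrow> 'a) \<Rightarrow> bool" where
  "weight_operator sc Gr W \<longleftrightarrow>
     Vector_Spaces.linear sc sc W \<and> (\<forall>k. \<forall>x \<in> Gr k. W x = sc (of_rat k) x)"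

definition commutator :: "('a::ab_group_add \<Rightarrow> 'a) \<Rightarrow> ('a \<Rightarrow> 'a) \<Rightarrow> 'a \<Rightarrow> 'a" where
  "commutator A B = (\<lambda>x. A (B x) - B (A x))"

text \<open>
  The coefficient of \<open>D\<^sup>r f \<cdot> D\<^sup>s g\<close>, with \<open>r + s = n\<close>, in the \<open>n\<close>-th Rankin--Cohen bracket of
  \<open>f\<close>, \<open>g\<close> of weights \<open>k\<close>, \<open>l\<close>.  The factors \<open>(k + n - 1)\<^sub>s / s!\<close> and \<open>(l + n - 1)\<^sub>r / r!\<close> are binomial
  coefficients, i.e. \<open>(\<alpha>)\<^sub>s\<close> is the descending product \<open>\<alpha>(\<alpha> - 1)\<cdots>(\<alpha> - s + 1)\<close>: the
  ascending product does not give modular brackets for \<open>n \<ge> 2\<close>.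
\<close>
definition rc_coeff :: "'k::field_char_0 \<Rightarrow> 'k \<Rightarrow> nat \<Rightarrow> nat \<Rightarrow> 'k" where
  "rc_coeff k l n r =
     (- 1) ^ r * ((k + of_nat n - 1) gchoose (n - r)) * ((l + of_nat n - 1) gchoose r)"

text \<open>Brackets are bilinear on the whole space; the formulas specify them on homogeneous elements.\<close>
locale bracket_family = graded_algebra sc N Gr
  for sc :: "'k::field_char_0 \<Rightarrow> 'a::comm_ring_1 \<Rightarrow> 'a" and N Gr +
  fixes br :: "nat \<Rightarrow> 'a \<Rightarrow> 'a \<Rightarrow> 'a"
  assumes br_linear_left: "\<And>n y. Vector_Spaces.linear sc sc (\<lambda>x. br n x y)"
    and br_linear_right: "\<And>n x. Vector_Spaces.linear sc sc (\<lambda>y. br n x y)"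
    and br_Gr: "\<And>n k l x y. x \<in> Gr k \<Longrightarrow> y \<in> Gr l \<Longrightarrow> br n x y \<in> Gr (k + l + 2 * of_nat n)"

definition std_bracket ::
  "('k::field_char_0 \<Rightarrow> 'a::comm_ring_1 \<Rightarrow> 'a) \<Rightarrow> ('a \<Rightarrow> 'a) \<Rightarrow> nat \<Rightarrow> rat \<Rightarrow> rat \<Rightarrow> 'a \<Rightarrow> 'a \<Rightarrow> 'a" where
  "std_bracket sc D n k l f g =
     (\<Sum>r\<le>n. sc (rc_coeff (of_rat k) (of_rat l) n r) ((D ^^ r) f * (D ^^ (n - r)) g))"

definition standard_RC_algebra ::
  "('k::field_char_0 \<Rightarrow> 'a::comm_ring_1 \<Rightarrow> 'a) \<Rightarrow> nat \<Rightarrow> (rat \<Rightarrow> 'a set) \<Rightarrow>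
   (nat \<Rightarrow> 'a \<Rightarrow> 'a \<Rightarrow> 'a) \<Rightarrow> ('a \<Rightarrow> 'a) \<Rightarrow> bool" where
  "standard_RC_algebra sc N Gr br D \<longleftrightarrow>
     bracket_family sc N Gr br \<and> derivation_deg2 sc Gr D \<and>
     (\<forall>n k l. \<forall>f \<in> Gr k. \<forall>g \<in> Gr l. br n f g = std_bracket sc D n k l f g)"

fun canon_seq ::
  "('k::field_char_0 \<Rightarrow> 'a::comm_ring_1 \<Rightarrow> 'a) \<Rightarrow> ('a \<Rightarrow> 'a) \<Rightarrow> 'a \<Rightarrow> rat \<Rightarrow> 'a \<Rightarrow> nat \<Rightarrow> 'a" where
  "canon_seq sc d \<Phi> k f 0 = f"
| "canon_seq sc d \<Phi> k f (Suc 0) = d f"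
| "canon_seq sc d \<Phi> k f (Suc (Suc r)) =
     d (canon_seq sc d \<Phi> k f (Suc r)) +
     sc (of_nat (Suc r) * (of_nat (Suc r) + of_rat k - 1)) (\<Phi> * canon_seq sc d \<Phi> k f r)"

definition canon_bracket ::
  "('k::field_char_0 \<Rightarrow> 'a::comm_ring_1 \<Rightarrow> 'a) \<Rightarrow> ('a \<Rightarrow> 'a) \<Rightarrow> 'a \<Rightarrow> nat \<Rightarrow> rat \<Rightarrow> rat \<Rightarrow> 'a \<Rightarrow> 'a \<Rightarrow> 'a" where
  "canon_bracket sc d \<Phi> n k l f g =
     (\<Sum>r\<le>n. sc (rc_coeff (of_rat k) (of_rat l) n r)
        (canon_seq sc d \<Phi> k f r * canon_seq sc d \<Phi> l g (n - r)))"

definition canonical_RC_algebra ::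
  "('k::field_char_0 \<Rightarrow> 'a::comm_ring_1 \<Rightarrow> 'a) \<Rightarrow> nat \<Rightarrow> (rat \<Rightarrow> 'a set) \<Rightarrow>
   (nat \<Rightarrow> 'a \<Rightarrow> 'a \<Rightarrow> 'a) \<Rightarrow> bool" where
  "canonical_RC_algebra sc N Gr br \<longleftrightarrow>
     bracket_family sc N Gr br \<and>
     (\<exists>d \<Phi>. derivation_deg2 sc Gr d \<and> \<Phi> \<in> Gr 4 \<and>
       (\<forall>n k l. \<forall>f \<in> Gr k. \<forall>g \<in> Gr l. br n f g = canon_bracket sc d \<Phi> n k l f g))"

definition upper_half :: "complex set" where
  "upper_half = {z. Im z > 0}"

definition principal_congruence :: "nat \<Rightarrow> (int^2^2) set" where
  "principal_congruence m =
     {A. det A = 1 \<and> (\<forall>i j. int m dvd (A $ i $ j - mat 1 $ i $ j))}"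

definition automorphy :: "int^2^2 \<Rightarrow> complex \<Rightarrow> complex" where
  "automorphy A z = of_int (A $ 2 $ 1) * z + of_int (A $ 2 $ 2)"

definition moebius_act :: "int^2^2 \<Rightarrow> complex \<Rightarrow> complex" where
  "moebius_act A z = (of_int (A $ 1 $ 1) * z + of_int (A $ 1 $ 2)) / automorphy A z"

text \<open>
  Modular forms of rational weight, with a unitary multiplier \<open>v\<close> (which absorbs the branch of
  the power).  Level \<open>m\<close> is arbitrary below, so every congruence subgroup is covered; the
  last conjunct, over all of \<open>SL\<^sub>2(\<int>)\<close>, is holomorphy at all cusps.
\<close>
definition modular_form :: "nat \<Rightarrow> rat \<Rightarrow> (complex \<Rightarrow> complex) \<Rightarrow> bool" where
  "modular_form m k f \<longleftrightarrow>
     f holomorphic_on upper_half \<and>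
     (\<exists>v. \<forall>A \<in> principal_congruence m. cmod (v A) = 1 \<and>
        (\<forall>z \<in> upper_half. f (moebius_act A z) = v A * automorphy A z powr of_rat k * f z)) \<and>
     (\<forall>A. det A = 1 \<longrightarrow> (\<exists>Y > 0. \<exists>C. \<forall>z. Im z \<ge> Y \<longrightarrow>
        cmod (f (moebius_act A z)) \<le> C * cmod (automorphy A z) powr of_rat k))"

definition modular_bracket ::
  "nat \<Rightarrow> rat \<Rightarrow> rat \<Rightarrow> (complex \<Rightarrow> complex) \<Rightarrow> (complex \<Rightarrow> complex) \<Rightarrow> complex \<Rightarrow> complex" where
  "modular_bracket n k l f g = (\<lambda>z.
     \<Sum>r\<le>n. rc_coeff (of_rat k) (of_rat l) n r * (deriv ^^ r) f z * (deriv ^^ (n - r)) g z)"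

text \<open>
  By bilinearity every expression built from brackets is a linear combination of bracket monomials.
  The monomial \<open>rc_One\<close> stands for the constant modular form \<open>1\<close>.
\<close>
datatype rc_mono = rc_Var nat | rc_One | rc_Br nat rc_mono rc_mono

primrec rc_weight :: "(nat \<Rightarrow> rat) \<Rightarrow> rc_mono \<Rightarrow> rat" where
  "rc_weight d (rc_Var i) = d i"
| "rc_weight d rc_One = 0"
| "rc_weight d (rc_Br n s t) = rc_weight d s + rc_weight d t + 2 * of_nat n"

primrec rc_eval ::
  "(nat \<Rightarrow> rat \<Rightarrow> rat \<Rightarrow> 'a \<Rightarrow> 'a \<Rightarrow> 'a) \<Rightarrow> 'a \<Rightarrow> (nat \<Rightarrow> rat) \<Rightarrow> (nat \<Rightarrow> 'a) \<Rightarrow> rc_mono \<Rightarrow> 'a" where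
  "rc_eval b u d x (rc_Var i) = x i"
| "rc_eval b u d x rc_One = u"
| "rc_eval b u d x (rc_Br n s t) =
     b n (rc_weight d s) (rc_weight d t) (rc_eval b u d x s) (rc_eval b u d x t)"

text \<open>
  A linear combination of bracket monomials in variables of weights \<open>d 0, d 1, \<dots>\<close> that vanishes
  on modular forms.  Coefficients are rational: the brackets have rational coefficients, so
  identities over any field of characteristic zero are spanned by rational ones.
\<close>
definition modular_identity :: "(nat \<Rightarrow> rat) \<Rightarrow> (rat \<times> rc_mono) list \<Rightarrow> bool" where
  "modular_identity d ps \<longleftrightarrow>
     (\<forall>m F. m > 0 \<longrightarrow> (\<forall>i. modular_form m (d i) (F i)) \<longrightarrow>
       (\<forall>z \<in> upper_half. (\<Sum>(c, t) \<leftarrow> ps. of_rat c * rc_eval modular_bracket (\<lambda>_. 1) d F t z) = 0))"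

text \<open>
  The 0-th modular bracket is the product, which is commutative, associative and has the unit \<open>1\<close>;
  by the identities the same holds for \<open>br 0\<close>, which is therefore taken as the ring multiplication.
\<close>
locale RC_algebra = bracket_family sc N Gr br
  for sc :: "'k::field_char_0 \<Rightarrow> 'a::comm_ring_1 \<Rightarrow> 'a" and N Gr br +
  assumes br_0: "\<And>x y. br 0 x y = x * y"
    and identities: "\<And>d ps x. modular_identity d ps \<Longrightarrow> (\<And>i. d i \<ge> 0) \<Longrightarrow> (\<And>i. x i \<in> Gr (d i)) \<Longrightarrow>
      (\<Sum>(c, t) \<leftarrow> ps. sc (of_rat c) (rc_eval (\<lambda>n _ _. br n) 1 d x t)) = 0"

inductive_set rc_generated ::
  "('k \<Rightarrow> 'a::comm_ring_1 \<Rightarrow> 'a) \<Rightarrow> (nat \<Rightarrow> 'a \<Rightarrow> 'a \<Rightarrow> 'a) \<Rightarrow> 'a set \<Rightarrow> 'a set"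
  for sc br S where
  gen: "x \<in> S \<Longrightarrow> x \<in> rc_generated sc br S"
| one: "1 \<in> rc_generated sc br S"
| add: "x \<in> rc_generated sc br S \<Longrightarrow> y \<in> rc_generated sc br S \<Longrightarrow> x + y \<in> rc_generated sc br S"
| scl: "x \<in> rc_generated sc br S \<Longrightarrow> sc c x \<in> rc_generated sc br S"
| bracket: "x \<in> rc_generated sc br S \<Longrightarrow> y \<in> rc_generated sc br S \<Longrightarrow> br n x y \<in> rc_generated sc br S"

definition rc_finitely_generated ::
  "('k \<Rightarrow> 'a::comm_ring_1 \<Rightarrow> 'a) \<Rightarrow> (nat \<Rightarrow> 'a \<Rightarrow> 'a \<Rightarrow> 'a) \<Rightarrow> bool" where
  "rc_finitely_generated sc br \<longleftrightarrow> (\<exists>S. finite S \<and> rc_generated sc br S = UNIV)"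

text \<open>
  \<open>(M, br)\<close>, identified with its image under \<open>\<iota>\<close>, is a sub-RC algebra of \<open>(M', br')\<close>: the image is a
  graded subalgebra closed under all brackets, with the induced grading and brackets.
\<close>
definition sub_RC_algebra ::
  "('k::field \<Rightarrow> 'a::comm_ring_1 \<Rightarrow> 'a) \<Rightarrow> (rat \<Rightarrow> 'a set) \<Rightarrow> (nat \<Rightarrow> 'a \<Rightarrow> 'a \<Rightarrow> 'a) \<Rightarrow>
   ('k \<Rightarrow> 'b::comm_ring_1 \<Rightarrow> 'b) \<Rightarrow> (rat \<Rightarrow> 'b set) \<Rightarrow> (nat \<Rightarrow> 'b \<Rightarrow> 'b \<Rightarrow> 'b) \<Rightarrow> ('a \<Rightarrow> 'b) \<Rightarrow> bool" where
  "sub_RC_algebra sc Gr br sc' Gr' br' \<iota> \<longleftrightarrow>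
     Vector_Spaces.linear sc sc' \<iota> \<and> inj \<iota> \<and> \<iota> 1 = 1 \<and>
     (\<forall>x y. \<iota> (x * y) = \<iota> x * \<iota> y) \<and>
     (\<forall>k. \<iota> ` Gr k = range \<iota> \<inter> Gr' k) \<and>
     (\<forall>n x y. \<iota> (br n x y) = br' n (\<iota> x) (\<iota> y))"

definition poly_scale :: "('k \<Rightarrow> 'a::comm_ring_1 \<Rightarrow> 'a) \<Rightarrow> 'k \<Rightarrow> 'a poly \<Rightarrow> 'a poly" where
  "poly_scale sc c p = smult (sc c 1) p"

text \<open>The variable \<open>t\<^sub>1 = [:0, 1:]\<close> has degree 2.\<close>
definition poly_grading :: "(rat \<Rightarrow> 'a::comm_ring_1 set) \<Rightarrow> rat \<Rightarrow> 'a poly set" where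
  "poly_grading Gr k = {p. \<forall>i. coeff p i \<in> Gr (k - 2 * of_nat i)}"

definition sl2_relations ::
  "('k::field_char_0 \<Rightarrow> 'a::comm_ring_1 \<Rightarrow> 'a) \<Rightarrow> ('a \<Rightarrow> 'a) \<Rightarrow> ('a \<Rightarrow> 'a) \<Rightarrow> ('a \<Rightarrow> 'a) \<Rightarrow> bool" where
  "sl2_relations sc D \<delta> W \<longleftrightarrow>
     commutator D \<delta> = W \<and>
     commutator W D = (\<lambda>x. sc 2 (D x)) \<and>
     commutator W \<delta> = (\<lambda>x. sc (- 2) (\<delta> x))"

end

theory Submission
  imports Defs
begin

text \<open>
  Both directions rest on one computation in \<open>M[t\<^sub>1]\<close>. If \<open>[D, \<delta>] = W\<close> and \<open>\<delta> f = 0\<close> with \<open>f\<close> of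
  weight \<open>k\<close>, then \<open>\<delta> (D\<^sup>r f) = - r (k + r - 1) D\<^bsup>r-1\<^esup> f\<close>. Hence \<open>\<delta>\<close> kills the standard brackets of
  elements of \<open>M\<close> by telescoping; they lie in \<open>ker \<delta> = M\<close> and equal their values at \<open>t\<^sub>1 = 0\<close>.
  If moreover \<open>D p = d p - \<Phi> \<delta> p\<close> at \<open>t\<^sub>1 = 0\<close> for all \<open>p\<close>, then the values \<open>f\<^sub>r\<close> of \<open>D\<^sup>r f\<close> at
  \<open>t\<^sub>1 = 0\<close> satisfy the canonical recursion, so standard brackets restrict to canonical ones.

  Given \<open>d\<close> and \<open>\<Phi>\<close>, take \<open>\<delta> = - \<partial>/\<partial>t\<^sub>1\<close>, \<open>D f = d f + k t\<^sub>1 f\<close> on \<open>M\<^sub>k\<close> and \<open>D t\<^sub>1 = t\<^sub>1\<^sup>2 + \<Phi>\<close>.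
  Conversely, \<open>u = \<delta> t\<^sub>1\<close> has weight 0, so it lies in \<open>M\<close>, and the coefficient of \<open>t\<^sub>1\<close> in
  \<open>[D, \<delta>] t\<^sub>1 = 2 t\<^sub>1\<close> shows that \<open>u v = - 1\<close>, where \<open>v\<close> is the coefficient of \<open>t\<^sub>1\<^sup>2\<close> in \<open>D t\<^sub>1\<close>;
  one takes \<open>d f\<close> and \<open>\<Phi>\<close> to be the values of \<open>D f\<close> and \<open>v D t\<^sub>1\<close> at \<open>t\<^sub>1 = 0\<close>.
\<close>

section \<open>The formal derivative on polynomials over a commutative ring\<close>

text \<open>The library's \<open>pderiv\<close> requires a coefficient ring without zero divisors.\<close>

definition formal_deriv :: "'a::comm_ring_1 poly \<Rightarrow> 'a poly" where
  "formal_deriv p = (\<Sum>i<degree p. monom (of_nat (Suc i) * coeff p (Suc i)) i)"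

lemma coeff_formal_deriv [simp]: "coeff (formal_deriv p) i = of_nat (Suc i) * coeff p (Suc i)"
proof -
  have "coeff (formal_deriv p) i =
      (\<Sum>j<degree p. if j = i then of_nat (Suc j) * coeff p (Suc j) else 0)"
    by (simp add: formal_deriv_def coeff_sum del: of_nat_Suc)
  also have "\<dots> = (if i < degree p then of_nat (Suc i) * coeff p (Suc i) else 0)"
    by (simp del: of_nat_Suc)
  \<comment> \<open>Beyond the degree both sides vanish, so truncating the defining sum loses
    nothing.\<close>
  also have "\<dots> = of_nat (Suc i) * coeff p (Suc i)"
    by (simp add: coeff_eq_0)
  finally show ?thesis .
qed

text \<open>This is the Leibniz rule for the variable times \<open>p\<close>; it drives the
  induction behind the general product rule.\<close>

lemma formal_deriv_pCons [simp]: "formal_deriv (pCons a p) = p + pCons 0 (formal_deriv p)"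
  by (rule poly_eqI) (simp add: coeff_pCons algebra_simps split: nat.split)

lemma formal_deriv_add: "formal_deriv (p + q) = formal_deriv p + formal_deriv q"
  by (rule poly_eqI) (simp add: algebra_simps)

lemma formal_deriv_smult: "formal_deriv (smult a p) = smult a (formal_deriv p)"
  by (rule poly_eqI) (simp add: algebra_simps)

lemma formal_deriv_0 [simp]: "formal_deriv 0 = 0"
  by (rule poly_eqI) simp

lemma formal_deriv_mult: "formal_deriv (p * q) = formal_deriv p * q + p * formal_deriv q"
  by (induction p) (simp_all add: formal_deriv_add formal_deriv_smult algebra_simps)

section \<open>Scalars and linear endomorphisms\<close>

context graded_algebra
begin

lemma scale_mult_left: "sc c x * y = sc c (x * y)"
  by (simp add: scale_mult)

lemma scale_mult_right: "x * sc c y = sc c (x * y)"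
  by (metis mult.commute scale_mult)

text \<open>Integer multiples in the ring become scalars of \<open>'k\<close>, where characteristic
  zero allows them to be cancelled even if the ring has zero divisors.\<close>

lemma scale_of_nat: "sc (of_nat n) x = of_nat n * x"
proof (induction n)
  case (Suc n)
  then show ?case
    by (simp add: scale_left_distrib distrib_right)
qed simp

lemma linear_iff: "Vector_Spaces.linear sc sc f \<longleftrightarrow>
    (\<forall>x y. f (x + y) = f x + f y) \<and> (\<forall>c x. f (sc c x) = sc c (f x))"
  using vector_space_axioms by (auto simp: Vector_Spaces.linear_iff)

lemma linearD:
  assumes "Vector_Spaces.linear sc sc f"
  shows "f (x + y) = f x + f y" "f (sc c x) = sc c (f x)" "f 0 = 0"
    "f (- x) = - f x" "f (x - y) = f x - f y" "f (sum g A) = (\<Sum>a\<in>A. f (g a))"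
proof -
  interpret module_hom sc sc f
    using assms by (simp add: linear_iff_module_hom)
  show "f (x + y) = f x + f y" "f (sc c x) = sc c (f x)" "f 0 = 0"
    "f (- x) = - f x" "f (x - y) = f x - f y" "f (sum g A) = (\<Sum>a\<in>A. f (g a))"
    by (simp_all add: add scale zero neg diff sum)
qed

lemma linear_compose:
  assumes "Vector_Spaces.linear sc sc f" "Vector_Spaces.linear sc sc g"
  shows "Vector_Spaces.linear sc sc (\<lambda>x. f (g x))"
  using assms by (simp add: linear_iff)

lemma linear_add:
  assumes "Vector_Spaces.linear sc sc f" "Vector_Spaces.linear sc sc g"
  shows "Vector_Spaces.linear sc sc (\<lambda>x. f x + g x)"
  using assms by (simp add: linear_iff scale_right_distrib algebra_simps)

lemma linear_diff:
  assumes "Vector_Spaces.linear sc sc f" "Vector_Spaces.linear sc sc g"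
  shows "Vector_Spaces.linear sc sc (\<lambda>x. f x - g x)"
  using assms by (simp add: linear_iff scale_right_diff_distrib algebra_simps)

lemma linear_scale:
  assumes "Vector_Spaces.linear sc sc f"
  shows "Vector_Spaces.linear sc sc (\<lambda>x. sc c (f x))"
  using assms by (simp add: linear_iff scale_right_distrib mult.commute)

lemma linear_sum:
  assumes "\<And>i. i \<in> I \<Longrightarrow> Vector_Spaces.linear sc sc (f i)"
  shows "Vector_Spaces.linear sc sc (\<lambda>x. \<Sum>i\<in>I. f i x)"
  using assms by (simp add: linear_iff sum.distrib scale_sum_right)

lemma linear_mult_left:
  assumes "Vector_Spaces.linear sc sc f"
  shows "Vector_Spaces.linear sc sc (\<lambda>x. a * f x)"
  using assms by (simp add: linear_iff scale_mult_right distrib_left)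

lemma linear_mult_right:
  assumes "Vector_Spaces.linear sc sc f"
  shows "Vector_Spaces.linear sc sc (\<lambda>x. f x * a)"
  using assms by (simp add: linear_iff scale_mult_left distrib_right)

lemma linear_ident: "Vector_Spaces.linear sc sc (\<lambda>x. x)"
  by (simp add: linear_iff)

lemma linear_funpow:
  assumes "Vector_Spaces.linear sc sc f"
  shows "Vector_Spaces.linear sc sc (f ^^ n)"
  by (induction n) (use assms in \<open>simp_all add: linear_iff\<close>)

section \<open>Homogeneous components\<close>

lemma Gr_0: "0 \<in> Gr k"
  using subspace_0 subspace_Gr by blast

text \<open>By \<open>direct_sum\<close> the described family is unique, so
  \<open>component k\<close> is the projection onto \<open>Gr k\<close>.\<close>

definition component :: "rat \<Rightarrow> 'a \<Rightarrow> 'a" where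
  "component k x = (THE h. finite {k. h k \<noteq> 0} \<and> (\<forall>k. h k \<in> Gr k) \<and>
     x = (\<Sum>k | h k \<noteq> 0. h k)) k"

lemma finite_support: "finite {k. component k x \<noteq> 0}"
  and component_Gr: "component k x \<in> Gr k"
  and sum_component: "(\<Sum>k | component k x \<noteq> 0. component k x) = x"
  using theI'[OF direct_sum[of x]] by (simp_all add: component_def)

text \<open>Extended by zero outside \<open>S\<close>, the family \<open>h\<close> satisfies the
  description in \<open>direct_sum\<close>. Since \<open>h\<close> may vanish inside
  \<open>S\<close>, the supports of several elements can share one index set.\<close>

lemma component_unique:
  assumes S: "finite S" and h: "\<And>k. k \<in> S \<Longrightarrow> h k \<in> Gr k" and x: "x = (\<Sum>k\<in>S. h k)"
  shows "component k x = (if k \<in> S then h k else 0)"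
proof -
  let ?h = "\<lambda>k. if k \<in> S then h k else 0"
  have sub: "{k. ?h k \<noteq> 0} \<subseteq> S"
    by auto
  have "x = (\<Sum>k\<in>S. ?h k)"
    using x by simp
  also have "\<dots> = (\<Sum>k | ?h k \<noteq> 0. ?h k)"
    by (rule sum.mono_neutral_right) (use S in auto)
  finally have "finite {k. ?h k \<noteq> 0} \<and> (\<forall>k. ?h k \<in> Gr k) \<and> x = (\<Sum>k | ?h k \<noteq> 0. ?h k)"
    using h Gr_0 finite_subset[OF sub S] by simp
  then have "(\<lambda>k. component k x) = ?h"
    by (intro Uniq_D[OF ex1_iff_ex_Uniq[THEN iffD1, OF direct_sum, THEN conjunct2, of x]])
      (simp_all add: finite_support component_Gr sum_component)
  then show ?thesis
    by metis
qed

lemma sum_component_superset: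
  assumes "finite S" "{k. component k x \<noteq> 0} \<subseteq> S"
  shows "(\<Sum>k\<in>S. component k x) = x"
proof -
  have "(\<Sum>k\<in>S. component k x) = (\<Sum>k | component k x \<noteq> 0. component k x)"
    by (rule sum.mono_neutral_right) (use assms in auto)
  then show ?thesis
    by (simp add: sum_component)
qed

lemma component_homogeneous:
  assumes "x \<in> Gr k"
  shows "component j x = (if j = k then x else 0)"
  using component_unique[of "{k}" "\<lambda>_. x" x j] assms by auto

lemma linear_component: "Vector_Spaces.linear sc sc (component k)"
proof -
  have "component k (x + y) = component k x + component k y" for x y
  proof -
    let ?S = "{k. component k x \<noteq> 0} \<union> {k. component k y \<noteq> 0}"
    have "x + y = (\<Sum>k\<in>?S. component k x + component k y)"
      using finite_support by (simp add: sum.distrib sum_component_superset)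
    then show ?thesis
      using component_unique[of ?S "\<lambda>k. component k x + component k y" "x + y" k]
        finite_support component_Gr subspace_Gr subspace_add by auto
  qed
  moreover have "component k (sc c x) = sc c (component k x)" for c x
  proof -
    let ?S = "{k. component k x \<noteq> 0}"
    have "sc c x = (\<Sum>k\<in>?S. sc c (component k x))"
      by (simp add: sum_component flip: scale_sum_right)
    then show ?thesis
      using component_unique[of ?S "\<lambda>k. sc c (component k x)" "sc c x" k]
        finite_support component_Gr subspace_Gr subspace_scale by auto
  qed
  ultimately show ?thesis
    by (simp add: linear_iff)
qed

lemma linear_eqI:
  assumes "Vector_Spaces.linear sc sc f" "Vector_Spaces.linear sc sc g"
    and "\<And>k x. x \<in> Gr k \<Longrightarrow> f x = g x"
  shows "f = g"
proof
  fix x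
  have "f (\<Sum>k | component k x \<noteq> 0. component k x) = g (\<Sum>k | component k x \<noteq> 0. component k x)"
    by (simp only: linearD[OF assms(1)] linearD[OF assms(2)] assms(3)[OF component_Gr])
  then show "f x = g x"
    by (simp add: sum_component)
qed

text \<open>Projecting \<open>W x = k x\<close> to weight \<open>j\<close> gives
  \<open>j x_j = k x_j\<close>, so in characteristic zero only the component of weight
  \<open>k\<close> survives.\<close>

lemma weight_eigenvector:
  assumes W: "weight_operator sc Gr W" and x: "W x = sc (of_rat k) x"
  shows "x \<in> Gr k"
proof -
  have "component j x = 0" if "j \<noteq> k" for j
  proof -
    \<comment> \<open>Both sides are linear, so it is enough to compare them on homogeneous
      elements.\<close>
    have "(\<lambda>x. component j (W x)) = (\<lambda>x. sc (of_rat j) (component j x))"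
    proof (rule linear_eqI)
      show "Vector_Spaces.linear sc sc (\<lambda>x. component j (W x))"
        using W by (auto intro: linear_compose linear_component simp: weight_operator_def)
      show "Vector_Spaces.linear sc sc (\<lambda>x. sc (of_rat j) (component j x))"
        by (intro linear_scale linear_component)
      show "component j (W y) = sc (of_rat j) (component j y)" if "y \<in> Gr i" for i y
        using W that by (simp add: weight_operator_def component_homogeneous
            linearD[OF linear_component])
    qed
    then have "sc (of_rat k) (component j x) = sc (of_rat j) (component j x)"
      using x by (metis linearD(2) linear_component)
    then show ?thesis
      using that by simp
  qed
  then have "x = component k x"
    using sum_component_superset[of "{k}" x] by force
  then show ?thesis
    using component_Gr by metis
qed

section \<open>Extension of weight-dependent formulas from homogeneous elements; the weight
  operator\<close>

text \<open>For linear \<open>\<phi> k\<close> this is the unique linear map that restricts to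
  \<open>\<phi> k\<close> on each \<open>Gr k\<close>. It yields the weight operator and, used
  twice, bilinear brackets from formulas that mention the weights.\<close>

definition extend :: "(rat \<Rightarrow> 'a \<Rightarrow> 'a) \<Rightarrow> 'a \<Rightarrow> 'a" where
  "extend \<phi> x = (\<Sum>k | component k x \<noteq> 0. \<phi> k (component k x))"

lemma extend_superset:
  assumes "\<And>k. \<phi> k 0 = 0" "finite S" "{k. component k x \<noteq> 0} \<subseteq> S"
  shows "extend \<phi> x = (\<Sum>k\<in>S. \<phi> k (component k x))"
  unfolding extend_def by (rule sum.mono_neutral_left) (use assms in auto)

lemma extend_homogeneous:
  assumes "\<And>k. \<phi> k 0 = 0" "x \<in> Gr k"
  shows "extend \<phi> x = \<phi> k x"
proof -
  have "{j. component j x \<noteq> 0} \<subseteq> {k}"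
    using assms by (auto simp: component_homogeneous)
  then show ?thesis
    using assms extend_superset[where \<phi> = \<phi> and S = "{k}" and x = x]
    by (simp add: component_homogeneous)
qed

lemma linear_extend:
  assumes \<phi>: "\<And>k. Vector_Spaces.linear sc sc (\<phi> k)"
  shows "Vector_Spaces.linear sc sc (extend \<phi>)"
proof -
  have 0: "\<phi> k 0 = 0" for k
    using linearD(3)[OF \<phi>] .
  have "extend \<phi> (x + y) = extend \<phi> x + extend \<phi> y" for x y
  proof -
    let ?S = "{k. component k x \<noteq> 0} \<union> {k. component k y \<noteq> 0}"
    have S: "finite ?S"
      using finite_support by blast
    have "{k. component k (x + y) \<noteq> 0} \<subseteq> ?S"
      by (auto simp: linearD[OF linear_component])
    then have "extend \<phi> (x + y) = (\<Sum>k\<in>?S. \<phi> k (component k (x + y)))"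
      using extend_superset[where \<phi> = \<phi>, OF 0 S] by blast
    also have "\<dots> = (\<Sum>k\<in>?S. \<phi> k (component k x)) + (\<Sum>k\<in>?S. \<phi> k (component k y))"
      by (simp add: linearD[OF linear_component] linearD[OF \<phi>] sum.distrib)
    also have "\<dots> = extend \<phi> x + extend \<phi> y"
      using extend_superset[where \<phi> = \<phi>, OF 0 S] by simp
    finally show ?thesis .
  qed
  moreover have "extend \<phi> (sc c x) = sc c (extend \<phi> x)" for c x
  proof -
    have "extend \<phi> (sc c x) = (\<Sum>k | component k x \<noteq> 0. \<phi> k (component k (sc c x)))"
      by (rule extend_superset[where \<phi> = \<phi>, OF 0 finite_support]) (auto simp: linearD[OF linear_component])
    then show ?thesis
      by (simp add: extend_def linearD[OF linear_component] linearD[OF \<phi>] scale_sum_right)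
  qed
  ultimately show ?thesis
    by (simp add: linear_iff)
qed

lemma weight_operator_extend: "weight_operator sc Gr (extend (\<lambda>k. sc (of_rat k)))"
  unfolding weight_operator_def
  by (auto intro!: linear_extend linear_scale linear_ident simp: extend_homogeneous)

text \<open>On homogeneous elements the Leibniz rule says that weights add under multiplication;
  linearity extends it one argument at a time.\<close>

lemma derivation_weight_operator:
  assumes W: "weight_operator sc Gr W"
  shows "derivation sc W"
proof -
  have lin: "Vector_Spaces.linear sc sc W"
    and hom: "\<And>k x. x \<in> Gr k \<Longrightarrow> W x = sc (of_rat k) x"
    using W by (auto simp: weight_operator_def)
  have *: "W (x * y) = W x * y + x * W y" if y: "y \<in> Gr l" for x y l
  proof -
    have "(\<lambda>x. W (x * y)) = (\<lambda>x. W x * y + x * W y)"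
    proof (rule linear_eqI)
      fix k x assume "x \<in> Gr k"
      with y show "W (x * y) = W x * y + x * W y"
        using hom[OF mult_Gr]
        by (simp add: hom scale_mult_left scale_mult_right of_rat_add scale_left_distrib)
    qed (use lin in \<open>simp_all add: linear_iff scale_mult_left scale_mult_right
        scale_right_distrib distrib_right distrib_left add_ac\<close>)
    then show ?thesis
      by meson
  qed
  have "(\<lambda>y. W (x * y)) = (\<lambda>y. W x * y + x * W y)" for x
    by (rule linear_eqI) (use lin * in
        \<open>simp_all add: linear_iff scale_mult_left scale_mult_right scale_right_distrib distrib_left
          distrib_right add_ac\<close>)
  then show ?thesis
    using lin unfolding derivation_def by meson
qed

section \<open>Standard brackets of a degree 2 derivation\<close>

lemma funpow_Gr:
  assumes "derivation_deg2 sc Gr D" "x \<in> Gr k"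
  shows "(D ^^ r) x \<in> Gr (k + 2 * of_nat r)"
proof (induction r)
  case (Suc r)
  then have "D ((D ^^ r) x) \<in> Gr (k + 2 * of_nat r + 2)"
    using assms by (auto simp: derivation_deg2_def)
  then show ?case
    by (simp add: algebra_simps)
qed (use assms in simp)

lemma std_bracket_Gr:
  assumes D: "derivation_deg2 sc Gr D" and x: "x \<in> Gr k" and y: "y \<in> Gr l"
  shows "std_bracket sc D n k l x y \<in> Gr (k + l + 2 * of_nat n)"
  unfolding std_bracket_def
proof (rule subspace_sum[OF subspace_Gr])
  fix r assume "r \<in> {..n}"
  then have "k + 2 * of_nat r + (l + 2 * of_nat (n - r)) = k + l + 2 * of_nat n"
    by (simp add: of_nat_diff)
  then have "(D ^^ r) x * (D ^^ (n - r)) y \<in> Gr (k + l + 2 * of_nat n)"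
    using mult_Gr[OF funpow_Gr[OF D x] funpow_Gr[OF D y]] by metis
  then show "sc (rc_coeff (of_rat k) (of_rat l) n r) ((D ^^ r) x * (D ^^ (n - r)) y)
      \<in> Gr (k + l + 2 * of_nat n)"
    by (rule subspace_scale[OF subspace_Gr])
qed

lemma standard_RC_algebra_exists:
  assumes D: "derivation_deg2 sc Gr D"
  shows "\<exists>br. standard_RC_algebra sc N Gr br D"
proof -
  define br where
    "br n x y = extend (\<lambda>k x. extend (\<lambda>l. std_bracket sc D n k l x) y) x" for n x y
  have D': "Vector_Spaces.linear sc sc (D ^^ r)" for r
    using D by (intro linear_funpow) (simp add: derivation_deg2_def derivation_def)
  have right: "Vector_Spaces.linear sc sc (std_bracket sc D n k l x)" for n k l x
    unfolding std_bracket_def by (intro linear_sum linear_scale linear_mult_left D')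
  have left: "Vector_Spaces.linear sc sc (\<lambda>x. std_bracket sc D n k l x y)" for n k l y
    unfolding std_bracket_def by (intro linear_sum linear_scale linear_mult_right D')
  have inner: "Vector_Spaces.linear sc sc (\<lambda>x. extend (\<lambda>l. std_bracket sc D n k l x) y)" for n k y
    unfolding extend_def by (intro linear_sum left)
  have hom: "br n x y = std_bracket sc D n k l x y" if "x \<in> Gr k" "y \<in> Gr l" for n x y k l
  proof -
    have "br n x y = extend (\<lambda>l. std_bracket sc D n k l x) y"
      unfolding br_def using linearD(3)[OF inner] that by (intro extend_homogeneous)
    also have "\<dots> = std_bracket sc D n k l x y"
      using linearD(3)[OF right] that by (intro extend_homogeneous)
    finally show ?thesis .
  qed
  have "bracket_family sc N Gr br"
  proof (intro bracket_family.intro bracket_family_axioms.intro graded_algebra_axioms)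
    show "Vector_Spaces.linear sc sc (\<lambda>x. br n x y)" for n y
      unfolding br_def by (intro linear_extend inner)
    show "Vector_Spaces.linear sc sc (\<lambda>y. br n x y)" for n x
      \<comment> \<open>Only the outer layer is unfolded: for fixed \<open>x\<close> the bracket is
        a finite sum of maps linear in \<open>y\<close>.\<close>
      unfolding br_def extend_def[of _ x] by (intro linear_sum linear_extend right)
    show "br n x y \<in> Gr (k + l + 2 * of_nat n)" if "x \<in> Gr k" "y \<in> Gr l" for n k l x y
      using that std_bracket_Gr[OF D] by (simp add: hom)
  qed
  then show ?thesis
    using D hom unfolding standard_RC_algebra_def by blast
qed

section \<open>The lowering operator on standard brackets\<close>

text \<open>Moving \<open>\<delta>\<close> past one more \<open>D\<close> costs \<open>W\<close>,
  which acts on \<open>(D ^^ j) f\<close> by \<open>k + 2 j\<close>. Summing over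
  \<open>j \<le> r\<close> gives \<open>(r + 1) (k + r)\<close>.\<close>

lemma lowering_funpow:
  assumes D: "derivation_deg2 sc Gr D" and W: "weight_operator sc Gr W"
    and comm: "commutator D \<delta> = W" and \<delta>: "Vector_Spaces.linear sc sc \<delta>"
    and f: "f \<in> Gr k" "\<delta> f = 0"
  shows "\<delta> ((D ^^ Suc r) f) = sc (- (of_nat (Suc r) * (of_rat k + of_nat r))) ((D ^^ r) f)"
proof -
  have lin: "Vector_Spaces.linear sc sc D"
    using D by (simp add: derivation_deg2_def derivation_def)
  have swap: "\<delta> (D x) = D (\<delta> x) - W x" for x
    using fun_cong[OF comm, of x] by (simp add: commutator_def algebra_simps)
  have Wr: "W ((D ^^ r) f) = sc (of_rat k + 2 * of_nat r) ((D ^^ r) f)" for r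
    using W funpow_Gr[OF D f(1), of r]
    by (auto simp: weight_operator_def of_rat_add of_rat_mult)
  show ?thesis
  proof (induction r)
    case 0
    show ?case
      using swap[of f] f linearD(3)[OF lin] Wr[of 0] by simp
  next
    case (Suc r)
    have "\<delta> ((D ^^ Suc (Suc r)) f) = D (\<delta> ((D ^^ Suc r) f)) - W ((D ^^ Suc r) f)"
      using swap by simp
    also have "\<dots> = sc (- (of_nat (Suc r) * (of_rat k + of_nat r)) - (of_rat k + 2 * of_nat (Suc r)))
        ((D ^^ Suc r) f)"
      unfolding Suc.IH Wr linearD(2)[OF lin] by (simp add: scale_left_diff_distrib)
    finally show ?case
      by (simp add: algebra_simps)
  qed
qed

text \<open>The two terms are what lowering \<open>(D ^^ Suc a) f\<close> and lowering
  \<open>(D ^^ (Suc m - a)) g\<close> contribute to the same product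
  \<open>(D ^^ a) f * (D ^^ (m - a)) g\<close>. The absorption identity \<open>step\<close> brings
  both to the same binomials, with opposite signs.\<close>

lemma rc_coeff_Suc:
  fixes \<kappa> \<mu> :: 'k
  assumes "a \<le> m"
  shows "rc_coeff \<kappa> \<mu> (Suc m) (Suc a) * (of_nat (Suc a) * (\<kappa> + of_nat a)) +
    rc_coeff \<kappa> \<mu> (Suc m) a * (of_nat (Suc m - a) * (\<mu> + of_nat (m - a))) = 0"
proof -
  have step: "(\<alpha> gchoose Suc j) * of_nat (Suc j) = (\<alpha> gchoose j) * (\<alpha> - of_nat j)" for \<alpha> :: 'k and j
    using gbinomial_mult_1[of \<alpha> j] by (simp add: algebra_simps)
  have 1: "(\<mu> + of_nat m gchoose Suc a) * of_nat (Suc a) =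
      (\<mu> + of_nat m gchoose a) * (\<mu> + of_nat (m - a))"
    using step[of "\<mu> + of_nat m" a] assms by (simp add: of_nat_diff)
  have 2: "(\<kappa> + of_nat m gchoose (Suc m - a)) * of_nat (Suc m - a) =
      (\<kappa> + of_nat m gchoose (m - a)) * (\<kappa> + of_nat a)"
    using step[of "\<kappa> + of_nat m" "m - a"] assms by (simp add: of_nat_diff Suc_diff_le)
  have "rc_coeff \<kappa> \<mu> (Suc m) (Suc a) * (of_nat (Suc a) * (\<kappa> + of_nat a)) =
      - ((- 1) ^ a * (\<kappa> + of_nat m gchoose (m - a)) * (\<kappa> + of_nat a) *
        ((\<mu> + of_nat m gchoose Suc a) * of_nat (Suc a)))"
    by (simp add: rc_coeff_def)
  also have "\<dots> = - ((- 1) ^ a * ((\<kappa> + of_nat m gchoose (m - a)) * (\<kappa> + of_nat a)) *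
        ((\<mu> + of_nat m gchoose a) * (\<mu> + of_nat (m - a))))"
    unfolding 1 by simp
  also have "\<dots> = - (rc_coeff \<kappa> \<mu> (Suc m) a * (of_nat (Suc m - a) * (\<mu> + of_nat (m - a))))"
    unfolding 2[symmetric] by (simp add: rc_coeff_def)
  finally show ?thesis
    by simp
qed

lemma lowering_std_bracket:
  assumes D: "derivation_deg2 sc Gr D" and W: "weight_operator sc Gr W"
    and comm: "commutator D \<delta> = W" and \<delta>: "derivation sc \<delta>"
    and f: "f \<in> Gr k" "\<delta> f = 0" and g: "g \<in> Gr l" "\<delta> g = 0"
  shows "\<delta> (std_bracket sc D n k l f g) = 0"
proof (cases n)
  case 0
  then show ?thesis
    using \<delta> f g by (simp add: std_bracket_def rc_coeff_def derivation_def)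
next
  case (Suc m)
  have lin: "Vector_Spaces.linear sc sc \<delta>" and prod: "\<And>x y. \<delta> (x * y) = \<delta> x * y + x * \<delta> y"
    using \<delta> by (auto simp: derivation_def)
  let ?c = "rc_coeff (of_rat k) (of_rat l) (Suc m) :: nat \<Rightarrow> 'k"
  let ?x = "\<lambda>r. (D ^^ r) f" and ?y = "\<lambda>r. (D ^^ r) g"
  note low_f = lowering_funpow[OF D W comm lin f] and low_g = lowering_funpow[OF D W comm lin g]
  have "\<delta> (std_bracket sc D n k l f g) =
      (\<Sum>r\<le>Suc m. sc (?c r) (\<delta> (?x r) * ?y (Suc m - r))) +
      (\<Sum>r\<le>Suc m. sc (?c r) (?x r * \<delta> (?y (Suc m - r))))"
    by (simp only: std_bracket_def Suc linearD[OF lin] prod scale_right_distrib sum.distrib)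
  \<comment> \<open>The term \<open>r = 0\<close> drops out because \<open>\<delta> f = 0\<close>;
    the others are reindexed by \<open>r = Suc a\<close>.\<close>
  also have "(\<Sum>r\<le>Suc m. sc (?c r) (\<delta> (?x r) * ?y (Suc m - r))) =
      (\<Sum>a\<le>m. sc (- (?c (Suc a) * (of_nat (Suc a) * (of_rat k + of_nat a)))) (?x a * ?y (m - a)))"
    unfolding sum.atMost_Suc_shift low_f by (simp add: f scale_mult_left)
  \<comment> \<open>Here the last term, \<open>r = Suc m\<close>, drops out because
    \<open>\<delta> g = 0\<close>.\<close>
  also have "(\<Sum>r\<le>Suc m. sc (?c r) (?x r * \<delta> (?y (Suc m - r)))) =
      (\<Sum>a\<le>m. sc (- (?c a * (of_nat (Suc m - a) * (of_rat l + of_nat (m - a))))) (?x a * ?y (m - a)))"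
  proof -
    have "sc (?c a) (?x a * \<delta> (?y (Suc m - a))) =
        sc (- (?c a * (of_nat (Suc m - a) * (of_rat l + of_nat (m - a))))) (?x a * ?y (m - a))"
      if "a \<le> m" for a
    proof -
      have "Suc m - a = Suc (m - a)"
        using that by simp
      then show ?thesis
        by (simp only: low_g) (simp add: scale_mult_right)
    qed
    then show ?thesis
      by (simp add: g)
  qed
  also have "(\<Sum>a\<le>m. sc (- (?c (Suc a) * (of_nat (Suc a) * (of_rat k + of_nat a)))) (?x a * ?y (m - a))) +
      (\<Sum>a\<le>m. sc (- (?c a * (of_nat (Suc m - a) * (of_rat l + of_nat (m - a))))) (?x a * ?y (m - a))) =
      (\<Sum>a\<le>m. sc (- (?c (Suc a) * (of_nat (Suc a) * (of_rat k + of_nat a)) +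
        ?c a * (of_nat (Suc m - a) * (of_rat l + of_nat (m - a))))) (?x a * ?y (m - a)))"
    unfolding sum.distrib[symmetric] scale_left_distrib[symmetric] minus_add_distrib ..
  also have "\<dots> = 0"
    by (intro sum.neutral ballI) (use rc_coeff_Suc in simp)
  finally show ?thesis .
qed

section \<open>Derivations and their commutators with the weight operator\<close>

lemma derivationD:
  assumes "derivation sc D"
  shows "D (x + y) = D x + D y" "D (sc c x) = sc c (D x)" "D 0 = 0" "D (- x) = - D x"
    "D (x - y) = D x - D y" "D (sum g A) = (\<Sum>a\<in>A. D (g a))" "D (x * y) = D x * y + x * D y"
  using assms linearD[of D] by (simp_all add: derivation_def)

lemma derivation_add:
  assumes "derivation sc A" "derivation sc B"
  shows "derivation sc (\<lambda>x. A x + B x)"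
  using assms by (simp add: derivation_def linear_add algebra_simps)

lemma derivation_mult_left:
  assumes "derivation sc A"
  shows "derivation sc (\<lambda>x. a * A x)"
  using assms by (simp add: derivation_def linear_mult_left algebra_simps)

lemma commutator_weight_operator:
  assumes W: "weight_operator sc Gr W" and A: "Vector_Spaces.linear sc sc A"
    and deg: "\<And>k x. x \<in> Gr k \<Longrightarrow> A x \<in> Gr (k + e)"
  shows "commutator W A = (\<lambda>x. sc (of_rat e) (A x))"
proof (rule linear_eqI)
  have lin: "Vector_Spaces.linear sc sc W"
    using W by (simp add: weight_operator_def)
  show "Vector_Spaces.linear sc sc (commutator W A)"
    unfolding commutator_def by (intro linear_diff linear_compose[OF lin A] linear_compose[OF A lin])
  show "Vector_Spaces.linear sc sc (\<lambda>x. sc (of_rat e) (A x))"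
    by (rule linear_scale[OF A])
  fix k x assume x: "x \<in> Gr k"
  with W deg[OF x] show "commutator W A x = sc (of_rat e) (A x)"
    by (simp add: commutator_def weight_operator_def of_rat_add scale_left_distrib linearD[OF A])
qed

section \<open>The graded algebra of polynomials\<close>

lemma coeff_poly_scale [simp]: "coeff (poly_scale sc c p) i = sc c (coeff p i)"
  by (simp add: poly_scale_def scale_mult_left)

lemma vector_space_poly: "vector_space (poly_scale sc)"
  by unfold_locales
    (auto intro!: poly_eqI simp: scale_right_distrib scale_left_distrib)

lemma graded_algebra_poly: "graded_algebra (poly_scale sc) N (poly_grading Gr)"
proof -
  interpret P: vector_space "poly_scale sc"
    by (rule vector_space_poly)
  have coeff_Gr: "coeff p i \<in> Gr (k - 2 * of_nat i)" if "p \<in> poly_grading Gr k" for p k i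
    using that by (simp add: poly_grading_def)
  show ?thesis
  proof (intro graded_algebra.intro graded_algebra_axioms.intro vector_space_poly N_pos)
    show "poly_scale sc c (x * y) = poly_scale sc c x * y" for c x y
      by (simp add: poly_scale_def)
    show "P.subspace (poly_grading Gr k)" for k
      using subspace_Gr by (simp add: P.subspace_def poly_grading_def subspace_def)
    show "\<exists>j. k = of_nat j / of_nat N" if "poly_grading Gr k \<noteq> {0}" for k
    proof -
      have "0 \<in> poly_grading Gr k"
        by (simp add: poly_grading_def Gr_0)
      with that obtain p where p: "p \<in> poly_grading Gr k" "p \<noteq> 0"
        by blast
      then obtain i where "coeff p i \<noteq> 0"
        by (auto simp: poly_eq_iff)
      with coeff_Gr[OF p(1)] have "Gr (k - 2 * of_nat i) \<noteq> {0}"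
        by blast
      then obtain j where "k - 2 * of_nat i = of_nat j / of_nat N"
        using degrees by blast
      \<comment> \<open>Adding the weight \<open>2 i\<close> of the \<open>i\<close>-th power of the
        variable keeps the denominator \<open>N\<close>.\<close>
      then have "k = of_nat (j + 2 * i * N) / of_nat N"
        using N_pos by (simp add: field_simps)
      then show ?thesis
        by blast
    qed
    show "1 \<in> poly_grading Gr 0"
      using one_Gr Gr_0 by (simp add: poly_grading_def)
    show "x * y \<in> poly_grading Gr (k + l)"
      if "x \<in> poly_grading Gr k" "y \<in> poly_grading Gr l" for k l x y
    proof -
      have "coeff x i * coeff y (n - i) \<in> Gr (k + l - 2 * of_nat n)" if "i \<le> n" for i n :: nat
      proof -
        have "k - 2 * of_nat i + (l - 2 * of_nat (n - i)) = k + l - 2 * of_nat n"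
          using that by (simp add: of_nat_diff)
        then show ?thesis
          using mult_Gr[OF coeff_Gr[OF \<open>x \<in> _\<close>, of i] coeff_Gr[OF \<open>y \<in> _\<close>, of "n - i"]]
          by metis
      qed
      then show ?thesis
        by (auto simp: poly_grading_def coeff_mult intro!: subspace_sum[OF subspace_Gr])
    qed
    show "\<exists>!h. finite {k. h k \<noteq> 0} \<and> (\<forall>k. h k \<in> poly_grading Gr k) \<and>
        p = (\<Sum>k | h k \<noteq> 0. h k)" for p :: "'a poly"
    proof
      \<comment> \<open>The \<open>i\<close>-th power of the variable has weight \<open>2 i\<close>,
        so the part of \<open>p\<close> of weight \<open>k\<close> takes from coefficient
        \<open>i\<close> its component of weight \<open>k - 2 i\<close>.\<close>
      let ?h = "\<lambda>k. \<Sum>i\<le>degree p. monom (component (k - 2 * of_nat i) (coeff p i)) i"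
      have coeff_h: "coeff (?h k) i = component (k - 2 * of_nat i) (coeff p i)" for k i
      proof -
        have "coeff (?h k) i =
            (\<Sum>j\<le>degree p. if j = i then component (k - 2 * of_nat j) (coeff p j) else 0)"
          by (simp add: coeff_sum)
        also have "\<dots> = (if i \<le> degree p then component (k - 2 * of_nat i) (coeff p i) else 0)"
          by simp
        also have "\<dots> = component (k - 2 * of_nat i) (coeff p i)"
          by (simp add: coeff_eq_0 linearD[OF linear_component])
        finally show ?thesis .
      qed
      have h_Gr: "?h k \<in> poly_grading Gr k" for k
        by (simp only: poly_grading_def mem_Collect_eq coeff_h component_Gr simp_thms)
      \<comment> \<open>A finite set containing every weight that can occur in
        \<open>p\<close>.\<close>
      let ?S = "\<Union>i\<le>degree p. (\<lambda>j. j + 2 * of_nat i) ` {j. component j (coeff p i) \<noteq> 0}"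
      have S: "k \<in> ?S" if "coeff (?h k) i \<noteq> 0" for k i
      proof -
        have "i \<le> degree p"
          using that unfolding coeff_h by (metis le_degree linearD(3) linear_component)
        moreover have "k = (k - 2 * of_nat i) + 2 * of_nat i"
          by simp
        ultimately show ?thesis
          using that unfolding coeff_h by blast
      qed
      have finS: "finite ?S"
        using finite_support by blast
      have sub: "{k. ?h k \<noteq> 0} \<subseteq> ?S"
        using S by (metis (mono_tags, lifting) coeff_0 mem_Collect_eq poly_eqI subsetI)
      have "p = (\<Sum>k\<in>?S. ?h k)"
      proof (rule poly_eqI)
        fix i
        \<comment> \<open>Shifting \<open>?S\<close> by \<open>2 i\<close> covers all weights of the
          single coefficient \<open>coeff p i\<close>.\<close>
        let ?T = "(\<lambda>k. k - 2 * of_nat i) ` ?S"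
        have "{j. component j (coeff p i) \<noteq> 0} \<subseteq> ?T"
        proof
          fix j assume "j \<in> {j. component j (coeff p i) \<noteq> 0}"
          then have "j + 2 * of_nat i \<in> ?S"
            using S[of "j + 2 * of_nat i" i] by (simp add: coeff_h)
          then show "j \<in> ?T"
            by (intro image_eqI[where x = "j + 2 * of_nat i"]) simp_all
        qed
        then have "coeff p i = (\<Sum>j\<in>?T. component j (coeff p i))"
          using sum_component_superset[of ?T] finS by simp
        also have "\<dots> = (\<Sum>k\<in>?S. component (k - 2 * of_nat i) (coeff p i))"
          by (subst sum.reindex) (simp_all add: inj_on_def)
        finally show "coeff p i = coeff (\<Sum>k\<in>?S. ?h k) i"
          by (simp only: coeff_sum[of _ ?S] coeff_h)
      qed
      also have "\<dots> = (\<Sum>k | ?h k \<noteq> 0. ?h k)"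
        by (rule sum.mono_neutral_right[OF finS sub]) blast
      finally show "finite {k. ?h k \<noteq> 0} \<and> (\<forall>k. ?h k \<in> poly_grading Gr k) \<and>
          p = (\<Sum>k | ?h k \<noteq> 0. ?h k)"
        using finite_subset[OF sub finS] h_Gr by blast
      fix h assume h: "finite {k. h k \<noteq> 0} \<and> (\<forall>k. h k \<in> poly_grading Gr k) \<and>
          p = (\<Sum>k | h k \<noteq> 0. h k)"
      \<comment> \<open>Projecting coefficient \<open>i\<close> of \<open>p\<close> to weight
        \<open>k - 2 i\<close> isolates the summand \<open>h k\<close>, since the other summands
        have other weights there.\<close>
      show "h = ?h"
      proof (intro ext poly_eqI)
        fix k i
        have "coeff p i = (\<Sum>j | h j \<noteq> 0. coeff (h j) i)"
          using arg_cong[OF conjunct2[OF conjunct2[OF h]], of "\<lambda>p. coeff p i"]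
          by (simp only: coeff_sum)
        then have "component (k - 2 * of_nat i) (coeff p i) =
            (\<Sum>j | h j \<noteq> 0. component (k - 2 * of_nat i) (coeff (h j) i))"
          by (simp only: linearD(6)[OF linear_component])
        also have "\<dots> = (\<Sum>j | h j \<noteq> 0. if j = k then coeff (h j) i else 0)"
        proof (intro sum.cong refl)
          fix j
          have "coeff (h j) i \<in> Gr (j - 2 * of_nat i)"
            using h coeff_Gr by blast
          then show "component (k - 2 * of_nat i) (coeff (h j) i) =
              (if j = k then coeff (h j) i else 0)"
            by (simp add: component_homogeneous)
        qed
        also have "\<dots> = coeff (h k) i"
          using h by simp
        finally show "coeff (h k) i = coeff (?h k) i"
          by (simp only: coeff_h)
      qed
    qed
  qed
qed

lemma const_poly_grading [simp]: "[:x:] \<in> poly_grading Gr k \<longleftrightarrow> x \<in> Gr k"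
  by (auto simp: poly_grading_def coeff_pCons Gr_0 split: nat.splits)

section \<open>Standard brackets of constants are canonical brackets\<close>

text \<open>The bracket is killed by \<open>\<delta>\<close>, hence constant, hence equal to its
  value at zero. Evaluation at zero is multiplicative, so only the constant terms of the iterates of
  \<open>D\<close> enter.\<close>

lemma std_bracket_const:
  assumes D: "derivation_deg2 (poly_scale sc) (poly_grading Gr) D"
    and W: "weight_operator (poly_scale sc) (poly_grading Gr) W"
    and comm: "commutator D \<delta> = W" and \<delta>: "derivation (poly_scale sc) \<delta>"
    and ker: "{p. \<delta> p = 0} = range (\<lambda>f. [:f:])"
    and D0: "\<And>p. coeff (D p) 0 = d (coeff p 0) - \<Phi> * coeff (\<delta> p) 0"
    and f: "f \<in> Gr k" and g: "g \<in> Gr l"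
  shows "std_bracket (poly_scale sc) D n k l [:f:] [:g:] = [:canon_bracket sc d \<Phi> n k l f g:]"
proof -
  interpret P: graded_algebra "poly_scale sc" N "poly_grading Gr"
    by (rule graded_algebra_poly)
  have lin: "Vector_Spaces.linear (poly_scale sc) (poly_scale sc) \<delta>"
    using \<delta> by (simp add: derivation_def)
  have const: "\<delta> [:x:] = 0" for x
    using ker by blast
  \<comment> \<open>The minus signs of \<open>D0\<close> and of the lowering formula cancel, which
    leaves the factor \<open>(r + 1) (r + j)\<close> of the canonical recursion.\<close>
  have seq: "coeff ((D ^^ r) [:x:]) 0 = canon_seq sc d \<Phi> j x r" if x: "x \<in> Gr j" for x j r
  proof (induction r rule: induct_nat_012)
    case (ge2 r)
    have "\<delta> ((D ^^ Suc r) [:x:]) =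
        poly_scale sc (- (of_nat (Suc r) * (of_rat j + of_nat r))) ((D ^^ r) [:x:])"
      using P.lowering_funpow[OF D W comm lin _ const] x by simp
    then have "coeff ((D ^^ Suc (Suc r)) [:x:]) 0 = d (coeff ((D ^^ Suc r) [:x:]) 0) -
        \<Phi> * sc (- (of_nat (Suc r) * (of_rat j + of_nat r))) (coeff ((D ^^ r) [:x:]) 0)"
      using D0[of "(D ^^ Suc r) [:x:]"] by simp
    then show ?case
      unfolding ge2 by (simp add: scale_mult_right algebra_simps)
  qed (use D0[of "[:x:]"] const in simp_all)
  have "\<delta> (std_bracket (poly_scale sc) D n k l [:f:] [:g:]) = 0"
    using P.lowering_std_bracket[OF D W comm \<delta> _ const _ const] f g by simp
  then obtain h where h: "std_bracket (poly_scale sc) D n k l [:f:] [:g:] = [:h:]"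
    using ker by blast
  have "h = coeff (std_bracket (poly_scale sc) D n k l [:f:] [:g:]) 0"
    by (simp add: h)
  also have "\<dots> = canon_bracket sc d \<Phi> n k l f g"
    by (simp add: std_bracket_def canon_bracket_def coeff_sum coeff_mult seq[OF f] seq[OF g])
  finally show ?thesis
    by (simp add: h)
qed

section \<open>From the \<open>sl2\<close> relations to a canonical structure\<close>

lemma canonical_RC_algebra_if_sl2:
  assumes br: "bracket_family sc N Gr br"
    and std: "standard_RC_algebra (poly_scale sc) N (poly_grading Gr) brT D"
    and sub: "sub_RC_algebra sc Gr br (poly_scale sc) (poly_grading Gr) brT (\<lambda>f. [:f:])"
    and \<delta>: "derivation (poly_scale sc) \<delta>" and ker: "{p. \<delta> p = 0} = range (\<lambda>f. [:f:])"
    and W: "weight_operator (poly_scale sc) (poly_grading Gr) W"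
    and sl2: "sl2_relations (poly_scale sc) D \<delta> W"
  shows "canonical_RC_algebra sc N Gr br"
proof -
  interpret P: graded_algebra "poly_scale sc" N "poly_grading Gr"
    by (rule graded_algebra_poly)
  have D2: "derivation_deg2 (poly_scale sc) (poly_grading Gr) D"
    using std by (simp add: standard_RC_algebra_def)
  then have D: "derivation (poly_scale sc) D"
    by (simp add: derivation_deg2_def)
  note D_simps = P.derivationD[OF D] and \<delta>_simps = P.derivationD[OF \<delta>]
  have comm: "commutator D \<delta> = W"
    using sl2 by (simp add: sl2_relations_def)
  have swap: "\<delta> (D p) = D (\<delta> p) - W p" for p
    using fun_cong[OF comm, of p] by (simp add: commutator_def algebra_simps)
  have const: "\<delta> [:x:] = 0" for x
    using ker by blast
  let ?t = "[:0, 1:] :: 'a poly"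
  have t_Gr: "?t \<in> poly_grading Gr 2"
    by (auto simp: poly_grading_def coeff_pCons Gr_0 one_Gr split: nat.splits)
  have Wt: "W ?t = poly_scale sc 2 ?t"
    using W t_Gr by (auto simp: weight_operator_def)
  \<comment> \<open>The variable has weight 2, and \<open>[W, \<delta>] = -2 \<delta>\<close> lowers
    it to 0.\<close>
  have W\<delta>: "W (\<delta> ?t) = 0"
  proof -
    have "W (\<delta> ?t) - \<delta> (W ?t) = poly_scale sc (- 2) (\<delta> ?t)"
      using sl2 by (auto simp: sl2_relations_def commutator_def dest: fun_cong[of _ _ ?t])
    then show ?thesis
      by (simp add: Wt \<delta>_simps)
  qed
  then have "\<delta> ?t \<in> poly_grading Gr 0"
    by (intro P.weight_eigenvector[OF W]) simp
  then have "coeff (\<delta> ?t) (Suc i) \<in> Gr (- 2 * of_nat (Suc i))" for i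
    unfolding poly_grading_def by (auto dest!: spec[of _ "Suc i"])
  \<comment> \<open>Degrees are nonnegative, so the higher coefficients of
    \<open>\<delta> ?t\<close>, having negative weight, vanish.\<close>
  moreover have "Gr (- 2 * of_nat (Suc i)) = {0}" for i
  proof (rule ccontr)
    assume "Gr (- 2 * of_nat (Suc i)) \<noteq> {0}"
    then obtain j :: nat where "- 2 * of_nat (Suc i) = (of_nat j / of_nat N :: rat)"
      using degrees by blast
    moreover have "(of_nat j / of_nat N :: rat) \<ge> 0"
      by simp
    moreover have "- 2 * of_nat (Suc i) < (0 :: rat)"
      by simp
    ultimately show False
      by linarith
  qed
  ultimately have "coeff (\<delta> ?t) (Suc i) = 0" for i
    by blast
  then obtain u where u: "\<delta> ?t = [:u:]"
    by (metis (no_types, lifting) coeff_pCons_0 coeff_pCons_Suc coeff_0 not0_implies_Suc poly_eqI)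
  have \<delta>_pCons: "\<delta> (pCons a p) = smult u p + pCons 0 (\<delta> p)" for a p
  proof -
    have "pCons a p = [:a:] + ?t * p"
      by simp
    then show ?thesis
      by (simp only: \<delta>_simps const u) simp
  qed
  define v where "v = coeff (D ?t) 2"
  have uv: "u * v = - 1"
  proof -
    \<comment> \<open>Since \<open>u\<close> is a constant of weight 0, \<open>D [:u:]\<close> lies
      in the kernel of \<open>\<delta>\<close> and has no linear term. So
      \<open>\<delta> (D ?t) = D [:u:] - 2 ?t\<close> has linear coefficient \<open>- 2\<close>,
      which \<open>coeff_\<delta>\<close> identifies with \<open>2 u v\<close>.\<close>
    have "\<delta> (D [:u:]) = D (\<delta> [:u:]) - W (\<delta> ?t)"
      using swap u by simp
    then have "D [:u:] \<in> {p. \<delta> p = 0}"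
      by (simp add: const D_simps W\<delta>)
    then have Du: "coeff (D [:u:]) 1 = 0"
      using ker by auto
    have coeff_\<delta>: "coeff (\<delta> p) 1 = 2 * (u * coeff p 2)" for p
    proof -
      obtain a b q where "p = pCons a (pCons b q)"
        by (metis pCons_cases)
      then show ?thesis
        by (simp add: \<delta>_pCons numeral_2_eq_2 numeral_poly)
    qed
    have "coeff (\<delta> (D ?t)) 1 = - 2"
      using Du scale_of_nat[of 2 1] by (simp add: swap u Wt)
    then have "sc 2 (u * v + 1) = 0"
      using coeff_\<delta>[of "D ?t"] scale_of_nat[of 2] by (simp add: v_def distrib_left)
    then show ?thesis
      by (simp add: eq_neg_iff_add_eq_0)
  qed
  have v: "v \<in> Gr 0"
  proof -
    have "D ?t \<in> poly_grading Gr (2 + 2)"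
      using D2 t_Gr unfolding derivation_deg2_def by blast
    then show ?thesis
      unfolding poly_grading_def v_def by (auto dest: spec[of _ 2])
  qed
  define d where "d x = coeff (D [:x:]) 0" for x
  \<comment> \<open>The factor \<open>v\<close> compensates for \<open>\<delta> ?t = u\<close>: by
    \<open>uv\<close>, \<open>- \<Phi> * u\<close> is the constant term of \<open>D ?t\<close>, as
    \<open>D0\<close> requires.\<close>
  define \<Phi> where "\<Phi> = v * coeff (D ?t) 0"
  have d: "derivation_deg2 sc Gr d"
    unfolding derivation_deg2_def derivation_def linear_iff
  proof (intro conjI allI ballI)
    fix x y c
    have "[:x + y:] = [:x:] + [:y:]" "[:sc c x:] = poly_scale sc c [:x:]" "[:x * y:] = [:x:] * [:y:]"
      by (simp_all add: poly_scale_def scale_mult_left)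
    then show "d (x + y) = d x + d y" "d (sc c x) = sc c (d x)" "d (x * y) = d x * y + x * d y"
      unfolding d_def by (simp_all only: D_simps) (simp_all add: coeff_mult)
  next
    fix k x assume "x \<in> Gr k"
    then have "D [:x:] \<in> poly_grading Gr (k + 2)"
      using D2 unfolding derivation_deg2_def by simp
    then show "d x \<in> Gr (k + 2)"
      unfolding poly_grading_def d_def by (auto dest: spec[of _ 0])
  qed
  have \<Phi>: "\<Phi> \<in> Gr 4"
  proof -
    have "D ?t \<in> poly_grading Gr (2 + 2)"
      using D2 t_Gr unfolding derivation_deg2_def by blast
    then have "coeff (D ?t) 0 \<in> Gr 4"
      unfolding poly_grading_def by (auto dest: spec[of _ 0])
    then show ?thesis
      using mult_Gr[OF v] by (simp add: \<Phi>_def)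
  qed
  \<comment> \<open>For \<open>p = a + ?t * q\<close> the summand \<open>?t * D q\<close> vanishes
    at zero, and \<open>\<delta> p\<close> has constant term \<open>u * coeff q 0\<close>.\<close>
  have D0: "coeff (D p) 0 = d (coeff p 0) - \<Phi> * coeff (\<delta> p) 0" for p
  proof (cases p)
    case (pCons a q)
    have "p = [:a:] + ?t * q"
      by (simp add: pCons)
    then have "coeff (D p) 0 = d a + coeff (D ?t) 0 * coeff q 0"
      by (simp only: D_simps) (simp add: d_def coeff_mult)
    also have "coeff (D ?t) 0 = - (u * v * coeff (D ?t) 0)"
      by (simp add: uv)
    finally show ?thesis
      by (simp add: pCons \<delta>_pCons \<Phi>_def algebra_simps)
  qed
  have "br n f g = canon_bracket sc d \<Phi> n k l f g" if "f \<in> Gr k" "g \<in> Gr l" for n k l f g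
  proof -
    have "[:br n f g:] = brT n [:f:] [:g:]"
      using sub by (simp add: sub_RC_algebra_def)
    also have "\<dots> = std_bracket (poly_scale sc) D n k l [:f:] [:g:]"
      using std that by (simp add: standard_RC_algebra_def)
    also have "\<dots> = [:canon_bracket sc d \<Phi> n k l f g:]"
      using std_bracket_const[OF D2 W comm \<delta> ker D0] that by blast
    finally show ?thesis
      by simp
  qed
  then show ?thesis
    using br d \<Phi> unfolding canonical_RC_algebra_def by blast
qed

section \<open>From a canonical structure to the \<open>sl2\<close> relations\<close>

lemma derivation_formal_deriv: "derivation (poly_scale sc) formal_deriv"
proof -
  interpret P: graded_algebra "poly_scale sc" N "poly_grading Gr"
    by (rule graded_algebra_poly)
  show ?thesis
    by (simp add: derivation_def P.linear_iff formal_deriv_add formal_deriv_mult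
        formal_deriv_smult poly_scale_def)
qed

text \<open>A positive integer acts as a nonzero scalar of \<open>'k\<close>, so it can be cancelled
  from each coefficient.\<close>

lemma formal_deriv_eq_0_iff: "formal_deriv p = (0 :: 'a poly) \<longleftrightarrow> p \<in> range (\<lambda>x. [:x:])"
proof
  assume "formal_deriv p = 0"
  then have "sc (of_nat (Suc i)) (coeff p (Suc i)) = 0" for i
    unfolding scale_of_nat by (metis coeff_0 coeff_formal_deriv)
  then have "coeff p (Suc i) = 0" for i
    by (simp del: of_nat_Suc)
  then have "p = [:coeff p 0:]"
    by (intro poly_eqI) (simp add: coeff_pCons split: nat.split)
  then show "p \<in> range (\<lambda>x. [:x:])"
    by blast
qed auto

text \<open>Acting on coefficients extends \<open>d\<close> to the derivation that kills the
  variable.\<close>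

lemma derivation_map_poly:
  assumes d: "derivation sc d"
  shows "derivation (poly_scale sc) (map_poly d)"
proof -
  interpret P: graded_algebra "poly_scale sc" N "poly_grading Gr"
    by (rule graded_algebra_poly)
  note d_simps = derivationD[OF d]
  have "map_poly d (p * q) = map_poly d p * q + p * map_poly d q" for p q
    by (rule poly_eqI) (simp add: coeff_map_poly coeff_mult d_simps sum.distrib)
  then show ?thesis
    by (auto simp: derivation_def P.linear_iff coeff_map_poly d_simps intro!: poly_eqI)
qed

lemma formal_deriv_map_poly:
  assumes d: "derivation sc d"
  shows "formal_deriv (map_poly d p) = map_poly d (formal_deriv p)"
proof (rule poly_eqI)
  fix i
  note d_simps = derivationD[OF d]
  have "of_nat (Suc i) * d (coeff p (Suc i)) = d (of_nat (Suc i) * coeff p (Suc i))"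
    unfolding scale_of_nat[symmetric] d_simps ..
  then show "coeff (formal_deriv (map_poly d p)) i = coeff (map_poly d (formal_deriv p)) i"
    by (simp add: coeff_map_poly d_simps del: of_nat_Suc)
qed

lemma sl2_if_canonical_RC_algebra:
  assumes "canonical_RC_algebra sc N Gr br"
  shows "\<exists>brT D. standard_RC_algebra (poly_scale sc) N (poly_grading Gr) brT D \<and>
       sub_RC_algebra sc Gr br (poly_scale sc) (poly_grading Gr) brT (\<lambda>f. [:f:]) \<and>
       (\<exists>\<delta> W. derivation (poly_scale sc) \<delta> \<and>
          {p. \<delta> p = 0} = range (\<lambda>f. [:f:]) \<and>
          weight_operator (poly_scale sc) (poly_grading Gr) W \<and>
          sl2_relations (poly_scale sc) D \<delta> W)"
proof -
  interpret P: graded_algebra "poly_scale sc" N "poly_grading Gr"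
    by (rule graded_algebra_poly)
  have br: "bracket_family sc N Gr br"
    using assms by (simp add: canonical_RC_algebra_def)
  obtain d \<Phi> where d2: "derivation_deg2 sc Gr d" and \<Phi>: "\<Phi> \<in> Gr 4"
    and canon: "\<And>n k l f g. f \<in> Gr k \<Longrightarrow> g \<in> Gr l \<Longrightarrow> br n f g = canon_bracket sc d \<Phi> n k l f g"
    using assms unfolding canonical_RC_algebra_def by blast
  have d: "derivation sc d"
    using d2 by (simp add: derivation_deg2_def)
  define w where "w = extend (\<lambda>k. sc (of_rat k))"
  have w: "weight_operator sc Gr w"
    unfolding w_def by (rule weight_operator_extend)
  then have w': "derivation sc w"
    by (rule derivation_weight_operator)
  let ?t = "[:0, 1:] :: 'a poly" and ?q = "[:\<Phi>, 0, 1:] :: 'a poly"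
  \<comment> \<open>On a constant of weight \<open>k\<close> the last summand vanishes and
    \<open>w\<close> supplies the factor \<open>k\<close>; on the variable only \<open>?q\<close>
    remains.\<close>
  define D where "D p = map_poly d p + ?t * map_poly w p + ?q * formal_deriv p" for p
  define \<delta> where "\<delta> p = - formal_deriv p" for p :: "'a poly"
  \<comment> \<open>The second summand accounts for the weight 2 of the variable.\<close>
  define W where "W p = map_poly w p + [:0, 2:] * formal_deriv p" for p
  note d_simps = derivationD[OF d] and w_simps = derivationD[OF w']
  note fd_simps = P.derivationD[OF derivation_formal_deriv]
  have D: "derivation (poly_scale sc) D"
    unfolding D_def by (intro P.derivation_add P.derivation_mult_left derivation_map_poly
        derivation_formal_deriv d w')
  have \<delta>: "derivation (poly_scale sc) \<delta>"
    using derivation_formal_deriv by (simp add: derivation_def P.linear_iff \<delta>_def)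
  have coeff_Gr: "coeff p i \<in> Gr (k - 2 * of_nat i)" if "p \<in> poly_grading Gr k" for p k i
    using that by (simp add: poly_grading_def)
  have fd_Gr: "formal_deriv p \<in> poly_grading Gr (k - 2)" if "p \<in> poly_grading Gr k" for p k
    unfolding poly_grading_def
  proof (intro CollectI allI)
    fix i
    have "k - 2 * of_nat (Suc i) = k - 2 - 2 * of_nat i"
      by simp
    then show "coeff (formal_deriv p) i \<in> Gr (k - 2 - 2 * of_nat i)"
      using subspace_scale[OF subspace_Gr coeff_Gr[OF that, of "Suc i"], of "of_nat (Suc i)"]
      unfolding coeff_formal_deriv scale_of_nat by metis
  qed
  have map_w_Gr: "map_poly w p \<in> poly_grading Gr k" if "p \<in> poly_grading Gr k" for p k
    unfolding poly_grading_def
  proof (intro CollectI allI)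
    fix i
    have "w (coeff p i) = sc (of_rat (k - 2 * of_nat i)) (coeff p i)"
      using coeff_Gr[OF that] w unfolding weight_operator_def by blast
    then show "coeff (map_poly w p) i \<in> Gr (k - 2 * of_nat i)"
      using subspace_scale[OF subspace_Gr coeff_Gr[OF that]] by (simp add: coeff_map_poly w_simps)
  qed
  have map_d_Gr: "map_poly d p \<in> poly_grading Gr (k + 2)" if "p \<in> poly_grading Gr k" for p k
    unfolding poly_grading_def
  proof (intro CollectI allI)
    fix i
    have "d (coeff p i) \<in> Gr (k - 2 * of_nat i + 2)"
      using coeff_Gr[OF that] d2 unfolding derivation_deg2_def by blast
    then show "coeff (map_poly d p) i \<in> Gr (k + 2 - 2 * of_nat i)"
      by (simp add: coeff_map_poly d_simps algebra_simps)
  qed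
  have t_Gr: "?t \<in> poly_grading Gr 2"
    by (auto simp: poly_grading_def coeff_pCons Gr_0 one_Gr split: nat.splits)
  have q_Gr: "?q \<in> poly_grading Gr 4"
    using \<Phi> by (auto simp: poly_grading_def coeff_pCons Gr_0 one_Gr split: nat.splits)
  have D2: "derivation_deg2 (poly_scale sc) (poly_grading Gr) D"
    unfolding derivation_deg2_def
  proof (intro conjI allI ballI D)
    fix k p assume p: "p \<in> poly_grading Gr k"
    have "?t * map_poly w p \<in> poly_grading Gr (k + 2)"
      using P.mult_Gr[OF t_Gr map_w_Gr[OF p]] by (simp add: add.commute)
    moreover have "?q * formal_deriv p \<in> poly_grading Gr (k + 2)"
      using P.mult_Gr[OF q_Gr fd_Gr[OF p]] by (simp add: algebra_simps)
    ultimately show "D p \<in> poly_grading Gr (k + 2)"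
      unfolding D_def using map_d_Gr[OF p] P.subspace_add[OF P.subspace_Gr] by blast
  qed
  have W: "weight_operator (poly_scale sc) (poly_grading Gr) W"
    unfolding weight_operator_def
  proof (intro conjI allI ballI)
    have "derivation (poly_scale sc) W"
      unfolding W_def by (intro P.derivation_add P.derivation_mult_left derivation_map_poly
          derivation_formal_deriv w')
    then show "Vector_Spaces.linear (poly_scale sc) (poly_scale sc) W"
      by (simp add: derivation_def)
    fix k p assume p: "p \<in> poly_grading Gr k"
    show "W p = poly_scale sc (of_rat k) p"
    proof (rule poly_eqI)
      fix i
      have "coeff ([:0, 2:] * formal_deriv p) i = sc (2 * of_nat i) (coeff p i)"
      proof (cases i)
        case (Suc j)
        have "sc (2 * of_nat (Suc j)) (coeff p (Suc j)) = 2 * (of_nat (Suc j) * coeff p (Suc j))"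
          using scale_of_nat[of "2 * Suc j"] by (simp only: of_nat_mult of_nat_numeral mult.assoc)
        then show ?thesis
          by (simp add: Suc)
      qed simp
      moreover have "w (coeff p i) = sc (of_rat (k - 2 * of_nat i)) (coeff p i)"
        using coeff_Gr[OF p] w unfolding weight_operator_def by blast
      ultimately have "coeff (W p) i =
          sc (of_rat (k - 2 * of_nat i)) (coeff p i) + sc (2 * of_nat i) (coeff p i)"
        by (simp only: W_def coeff_add coeff_map_poly w_simps)
      also have "\<dots> = sc (of_rat k) (coeff p i)"
        unfolding scale_left_distrib[symmetric] by (simp add: of_rat_diff of_rat_mult)
      finally show "coeff (W p) i = coeff (poly_scale sc (of_rat k) p) i"
        by simp
    qed
  qed
  have comm: "commutator D \<delta> = W"
  proof
    fix p
    have t: "formal_deriv ?t = 1" and q: "formal_deriv ?q = [:0, 2:]"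
      by (simp_all add: one_pCons)
    \<comment> \<open>As \<open>\<delta>\<close> is minus the formal derivative,
      \<open>[D, \<delta>]\<close> differentiates the coefficients \<open>?t\<close> and
      \<open>?q\<close> of \<open>D\<close>; this produces \<open>map_poly w\<close> and
      \<open>[:0, 2:] * formal_deriv\<close>, the two summands of \<open>W\<close>.\<close>
    have "formal_deriv (D p) = map_poly d (formal_deriv p) + map_poly w p +
        ?t * map_poly w (formal_deriv p) + [:0, 2:] * formal_deriv p +
        ?q * formal_deriv (formal_deriv p)"
      by (simp only: D_def fd_simps(1,7) formal_deriv_map_poly[OF d] formal_deriv_map_poly[OF w']
          t q mult_1 add.assoc)
    then show "commutator D \<delta> p = W p"
      by (simp add: commutator_def \<delta>_def P.derivationD[OF D] W_def) (simp add: D_def)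
  qed
  have "commutator W D = (\<lambda>p. poly_scale sc (of_rat 2) (D p))"
    using D2 by (intro P.commutator_weight_operator[OF W])
      (auto simp: derivation_deg2_def derivation_def)
  moreover have "commutator W \<delta> = (\<lambda>p. poly_scale sc (of_rat (- 2)) (\<delta> p))"
  proof (rule P.commutator_weight_operator[OF W])
    show "\<delta> p \<in> poly_grading Gr (k + - 2)" if "p \<in> poly_grading Gr k" for k p
      using P.subspace_neg[OF P.subspace_Gr fd_Gr[OF that]] by (simp add: \<delta>_def)
  qed (use \<delta> in \<open>simp add: derivation_def\<close>)
  ultimately have sl2: "sl2_relations (poly_scale sc) D \<delta> W"
    using comm by (simp add: sl2_relations_def of_rat_minus)
  have ker: "{p. \<delta> p = 0} = range (\<lambda>f. [:f:])"
    by (auto simp: \<delta>_def formal_deriv_eq_0_iff)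
  have D0: "coeff (D p) 0 = d (coeff p 0) - \<Phi> * coeff (\<delta> p) 0" for p
    by (simp add: D_def \<delta>_def coeff_map_poly coeff_mult d_simps)
  obtain brT where std: "standard_RC_algebra (poly_scale sc) N (poly_grading Gr) brT D"
    using P.standard_RC_algebra_exists[OF D2] by blast
  interpret B: bracket_family sc N Gr br
    by (rule br)
  interpret T: bracket_family "poly_scale sc" N "poly_grading Gr" brT
    using std by (simp add: standard_RC_algebra_def)
  have const_sum: "[:sum f S:] = (\<Sum>i\<in>S. [:f i:])" for S and f :: "rat \<Rightarrow> 'a"
    by (rule poly_eqI) (simp add: coeff_sum coeff_pCons split: nat.split)
  have hom: "brT n [:x:] [:y:] = [:br n x y:]" if "x \<in> Gr k" "y \<in> Gr l" for n x y k l
    using std that std_bracket_const[OF D2 W comm \<delta> ker D0 that]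
    by (simp add: standard_RC_algebra_def canon)
  have brT_sum: "brT n [:sum f S:] [:sum g R:] = (\<Sum>i\<in>S. \<Sum>j\<in>R. brT n [:f i:] [:g j:])"
    for n S R and f g :: "rat \<Rightarrow> 'a"
    unfolding const_sum P.linearD(6)[OF T.br_linear_left] P.linearD(6)[OF T.br_linear_right]
    by (rule sum.swap)
  \<comment> \<open>Both brackets are bilinear, so agreement on homogeneous elements spreads to sums
    of components.\<close>
  have "[:br n x y:] = brT n [:x:] [:y:]" for n x y
  proof -
    let ?x = "\<lambda>k. component k x" and ?y = "\<lambda>k. component k y"
    have "brT n [:\<Sum>k | ?x k \<noteq> 0. ?x k:] [:\<Sum>l | ?y l \<noteq> 0. ?y l:] =
        [:\<Sum>k | ?x k \<noteq> 0. \<Sum>l | ?y l \<noteq> 0. br n (?x k) (?y l):]"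
      unfolding brT_sum unfolding const_sum hom[OF component_Gr component_Gr] ..
    also have "(\<Sum>k | ?x k \<noteq> 0. \<Sum>l | ?y l \<noteq> 0. br n (?x k) (?y l)) =
        br n (\<Sum>k | ?x k \<noteq> 0. ?x k) (\<Sum>l | ?y l \<noteq> 0. ?y l)"
      unfolding linearD(6)[OF B.br_linear_left] linearD(6)[OF B.br_linear_right]
      by (rule sum.swap)
    finally show ?thesis
      by (simp add: sum_component)
  qed
  then have "sub_RC_algebra sc Gr br (poly_scale sc) (poly_grading Gr) brT (\<lambda>f. [:f:])"
    unfolding sub_RC_algebra_def Vector_Spaces.linear_iff
    using vector_space_axioms vector_space_poly
    by (auto simp: inj_on_def one_pCons poly_scale_def scale_mult_left)
  then show ?thesis
    using std \<delta> ker W sl2 by blast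
qed

end

theorem theorem2:
  fixes sc :: "'k::field_char_0 \<Rightarrow> 'm::comm_ring_1 \<Rightarrow> 'm"
    and N :: nat
    and Gr :: "rat \<Rightarrow> 'm set"
    and br :: "nat \<Rightarrow> 'm \<Rightarrow> 'm \<Rightarrow> 'm"
  assumes "RC_algebra sc N Gr br"
    and "rc_finitely_generated sc br"
  shows "canonical_RC_algebra sc N Gr br \<longleftrightarrow>
    (\<exists>brT D. standard_RC_algebra (poly_scale sc) N (poly_grading Gr) brT D \<and>
       sub_RC_algebra sc Gr br (poly_scale sc) (poly_grading Gr) brT (\<lambda>f. [:f:]) \<and>
       (\<exists>\<delta> W. derivation (poly_scale sc) \<delta> \<and>
          {p. \<delta> p = 0} = range (\<lambda>f. [:f:]) \<and>
          weight_operator (poly_scale sc) (poly_grading Gr) W \<and>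
          sl2_relations (poly_scale sc) D \<delta> W))"
proof -
  interpret RC_algebra sc N Gr br
    by (rule assms(1))
  show ?thesis
  proof
    assume "canonical_RC_algebra sc N Gr br"
    then show "\<exists>brT D. standard_RC_algebra (poly_scale sc) N (poly_grading Gr) brT D \<and>
       sub_RC_algebra sc Gr br (poly_scale sc) (poly_grading Gr) brT (\<lambda>f. [:f:]) \<and>
       (\<exists>\<delta> W. derivation (poly_scale sc) \<delta> \<and>
          {p. \<delta> p = 0} = range (\<lambda>f. [:f:]) \<and>
          weight_operator (poly_scale sc) (poly_grading Gr) W \<and>
          sl2_relations (poly_scale sc) D \<delta> W)"
      by (rule sl2_if_canonical_RC_algebra)
  qed (elim exE conjE, rule canonical_RC_algebra_if_sl2[OF bracket_family_axioms])
qed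

end
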